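(* Let $n\ge 2$ and let $P_n$ be the path on vertices $1,2,\ldots,n$ (consecutive labels adjacent). For $k=0,1,\ldots,n-1$ let $\theta_k=2-2\cos\frac{k\pi}{n}$ be the Laplacian eigenvalues of $P_n$ and $F_{\theta_k}$ the corresponding eigenprojectors. Let $1\le a\le n-1$ and $1\le b\le n-1$ be integers. Then $\mathbf{e}_a-\mathbf{e}_{a+1}$ and $\mathbf{e}_{n-b}-\mathbf{e}_{n-b+1}$ are Laplacian strongly cospectral if and only if $a=b$. Moreover, for $k\in\{0,1,\ldots,n-1\}$: $F_{\theta_k}(\mathbf{e}_a-\mathbf{e}_{a+1})=F_{\theta_k}(\mathbf{e}_{n-a}-\mathbf{e}_{n-a+1})=\mathbf{0}$ if and only if $n\mid ak$; $F_{\theta_k}(\mathbf{e}_a-\mathbf{e}_{a+1})=F_{\theta_k}(\mathbf{e}_{n-a}-\mathbf{e}_{n-a+1})\neq\mathbf{0}$ if and only if $k$ is odd and $n\nmid ak$; $F_{\theta_k}(\mathbf{e}_a-\mathbf{e}_{a+1})=-F_{\theta_k}(\mathbf{e}_{n-a}-\mathbf{e}_{n-a+1})\neq\mathbf{0}$ if and only if $k$ is even and $n\nmid ak$. In particular, $\mathrm{supp}_{L}(\mathbf{e}_a-\mathbf{e}_{a+1})=\mathrm{supp}_{L}(\mathbf{e}_{n-a}-\mathbf{e}_{n-a+1})=\{\theta_k: n\nmid ak\}$.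
   Context: $L$ is the Laplacian matrix $D-A$ of $P_n$; its eigenvalues $\theta_k$ are simple, and $F_{\theta_k}$ is the orthogonal projection onto the $\theta_k$-eigenspace. $\mathbf{e}_u$ is the standard unit vector at vertex $u$. $\mathrm{supp}_L(\mathbf{v})$ is the set of eigenvalues $\theta$ with $F_\theta\mathbf{v}\ne\mathbf{0}$. Two pair states $\mathbf{e}_a-\mathbf{e}_b$, $\mathbf{e}_c-\mathbf{e}_d$ are Laplacian strongly cospectral if $F_\theta(\mathbf{e}_a-\mathbf{e}_b)=\pm F_\theta(\mathbf{e}_c-\mathbf{e}_d)$ for every eigenvalue $\theta$.
   Formalization: The equivalence "strongly cospectral if and only if a=b" is stated only when a+b≠n or a=b; if a+b=n with a≠b (e.g. n=3, a=1, b=2) the two pair states are the same vector, hence trivially strongly cospectral, and the equivalence fails. *)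

theory Defs
  imports Complex_Main "Jordan_Normal_Form.Char_Poly"
begin

text \<open>A graph on the vertex set \<open>{1..n}\<close> is given by its adjacency relation. Rows, columns
  and vector entries are indexed from \<open>0\<close>, so vertex \<open>u\<close> has index \<open>u - 1\<close>.\<close>

definition adjacency_mat :: "nat \<Rightarrow> (nat \<Rightarrow> nat \<Rightarrow> bool) \<Rightarrow> real mat" where
  "adjacency_mat n E = mat n n (\<lambda>(i, j). if E (Suc i) (Suc j) then 1 else 0)"

definition degree_mat :: "nat \<Rightarrow> (nat \<Rightarrow> nat \<Rightarrow> bool) \<Rightarrow> real mat" where
  "degree_mat n E =
     mat n n (\<lambda>(i, j). if i = j then real (card {v \<in> {1..n}. E (Suc i) v}) else 0)"

definition laplacian :: "nat \<Rightarrow> (nat \<Rightarrow> nat \<Rightarrow> bool) \<Rightarrow> real mat" where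
  "laplacian n E = degree_mat n E - adjacency_mat n E"

definition path_adj :: "nat \<Rightarrow> nat \<Rightarrow> nat \<Rightarrow> bool" where
  "path_adj n u v \<longleftrightarrow> u \<in> {1..n} \<and> v \<in> {1..n} \<and> (v = u + 1 \<or> u = v + 1)"

definition eigenspace :: "real mat \<Rightarrow> real \<Rightarrow> real vec set" where
  "eigenspace A \<theta> = {v \<in> carrier_vec (dim_row A). A *\<^sub>v v = \<theta> \<cdot>\<^sub>v v}"

text \<open>The matrix of the orthogonal projection onto the eigenspace: \<open>P v\<close> lies in the eigenspace
  and \<open>v - P v\<close> is orthogonal to it. For a square matrix exactly one such \<open>P\<close> exists; it is the
  zero matrix if \<open>\<theta>\<close> is not an eigenvalue.\<close>

definition eigenprojector :: "real mat \<Rightarrow> real \<Rightarrow> real mat" where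
  "eigenprojector A \<theta> =
     (THE P. P \<in> carrier_mat (dim_row A) (dim_row A) \<and>
        (\<forall>v \<in> carrier_vec (dim_row A).
           P *\<^sub>v v \<in> eigenspace A \<theta> \<and>
           (\<forall>w \<in> eigenspace A \<theta>. (v - P *\<^sub>v v) \<bullet> w = 0)))"

definition pair_state :: "nat \<Rightarrow> nat \<Rightarrow> nat \<Rightarrow> real vec" where
  "pair_state n u v = unit_vec n (u - 1) - unit_vec n (v - 1)"

definition eigenvalue_support :: "real mat \<Rightarrow> real vec \<Rightarrow> real set" where
  "eigenvalue_support L v = {\<theta>. eigenvalue L \<theta> \<and> eigenprojector L \<theta> *\<^sub>v v \<noteq> 0\<^sub>v (dim_row L)}"

text \<open>The sign may depend on the eigenvalue.\<close>

definition strongly_cospectral :: "real mat \<Rightarrow> real vec \<Rightarrow> real vec \<Rightarrow> bool" where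
  "strongly_cospectral L v w \<longleftrightarrow>
     (\<forall>\<theta>. eigenvalue L \<theta> \<longrightarrow>
        eigenprojector L \<theta> *\<^sub>v v = eigenprojector L \<theta> *\<^sub>v w \<or>
        eigenprojector L \<theta> *\<^sub>v v = - (eigenprojector L \<theta> *\<^sub>v w))"

definition path_eigval :: "nat \<Rightarrow> nat \<Rightarrow> real" where
  "path_eigval n k = 2 - 2 * cos (real k * pi / real n)"

end

theory Submission
  imports Defs
begin

text \<open>The vector \<open>u\<^sub>k\<close> with entries \<open>cos ((2i + 1) k\<pi> / (2n))\<close> is an eigenvector for
  \<open>\<theta>\<^sub>k\<close>. An eigenvector of a path is determined by its first entry through the three-term
  recurrence, and \<open>u\<^sub>k\<close> has a nonzero first entry, so it spans the eigenspace. The \<open>\<theta>\<^sub>k\<close> are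
  \<open>n\<close> distinct roots of the characteristic polynomial, hence all the eigenvalues. The projection
  of \<open>e\<^sub>c - e\<^sub>c\<^sub>+\<^sub>1\<close> is therefore the multiple of \<open>u\<^sub>k\<close> with coefficient proportional to
  \<open>sin (k\<pi> / (2n)) sin (ck\<pi> / n)\<close>; everything is read off from this sine, and strong
  cospectrality already fails at \<open>k = 1\<close> unless \<open>sin (a\<pi> / n) = sin (b\<pi> / n)\<close>.\<close>

section \<open>Orthogonal projection onto a one-dimensional eigenspace\<close>

text \<open>\<open>eigenprojector\<close> is a definite description, so existence and uniqueness are
  both shown. Membership in the line makes \<open>P *\<^sub>v v\<close> a multiple of
  \<open>u\<close>, and orthogonality of the remainder to \<open>u\<close> fixes the factor.\<close>

lemma eigenprojector_line:
  fixes A :: "real mat"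
  assumes A: "A \<in> carrier_mat n n" and u: "u \<in> carrier_vec n" and u0: "u \<noteq> 0\<^sub>v n"
    and line: "eigenspace A \<theta> = {c \<cdot>\<^sub>v u | c. True}" and x: "x \<in> carrier_vec n"
  shows "eigenprojector A \<theta> *\<^sub>v x = ((u \<bullet> x) / (u \<bullet> u)) \<cdot>\<^sub>v u"
proof -
  define proj where "proj P \<longleftrightarrow> P \<in> carrier_mat (dim_row A) (dim_row A) \<and>
        (\<forall>v \<in> carrier_vec (dim_row A).
           P *\<^sub>v v \<in> eigenspace A \<theta> \<and>
           (\<forall>w \<in> eigenspace A \<theta>. (v - P *\<^sub>v v) \<bullet> w = 0))" for P
  have dim: "dim_row A = n" using A by simp
  \<comment> \<open>Conjugation is the identity on real vectors, so this is definiteness of the dot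
    product.\<close>
  have uu: "u \<bullet> u \<noteq> 0"
    using u0 conjugate_square_eq_0_vec[OF u] by simp
  have unique: "P *\<^sub>v v = ((u \<bullet> v) / (u \<bullet> u)) \<cdot>\<^sub>v u"
    if P: "proj P" and v: "v \<in> carrier_vec n" for P v
  proof -
    have "P *\<^sub>v v \<in> eigenspace A \<theta>" using P v by (simp add: proj_def dim)
    then obtain c where c: "P *\<^sub>v v = c \<cdot>\<^sub>v u" using line by auto
    have "u \<in> eigenspace A \<theta>" unfolding line by (rule CollectI, rule exI[of _ 1]) simp
    then have "(v - P *\<^sub>v v) \<bullet> u = 0" using P v by (simp add: proj_def dim)
    then have "v \<bullet> u - c * (u \<bullet> u) = 0"
      using v u by (simp add: c minus_scalar_prod_distrib[of _ n])
    then have "c = (u \<bullet> v) / (u \<bullet> u)"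
      using uu comm_scalar_prod[OF u v] by (simp add: field_simps)
    then show ?thesis using c by simp
  qed
  \<comment> \<open>The witness is the outer product of \<open>u\<close> with itself over its
    squared norm.\<close>
  define P where "P = mat n n (\<lambda>(i, j). u $ i * u $ j / (u \<bullet> u))"
  have Pv: "P *\<^sub>v v = ((u \<bullet> v) / (u \<bullet> u)) \<cdot>\<^sub>v u" if v: "v \<in> carrier_vec n" for v
  proof (rule eq_vecI)
    show "dim_vec (P *\<^sub>v v) = dim_vec (((u \<bullet> v) / (u \<bullet> u)) \<cdot>\<^sub>v u)"
      using u by (simp add: P_def)
    fix i assume "i < dim_vec (((u \<bullet> v) / (u \<bullet> u)) \<cdot>\<^sub>v u)"
    then have i: "i < n" using u by simp
    have "(P *\<^sub>v v) $ i = (\<Sum>j<n. u $ i * u $ j / (u \<bullet> u) * v $ j)"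
      using i v by (simp add: P_def scalar_prod_def atLeast0LessThan)
    also have "\<dots> = (\<Sum>j<n. u $ j * v $ j) / (u \<bullet> u) * u $ i"
      by (simp add: sum_distrib_left sum_divide_distrib mult_ac)
    also have "(\<Sum>j<n. u $ j * v $ j) = u \<bullet> v"
      using v by (simp add: scalar_prod_def atLeast0LessThan)
    finally show "(P *\<^sub>v v) $ i = (((u \<bullet> v) / (u \<bullet> u)) \<cdot>\<^sub>v u) $ i"
      using i u by simp
  qed
  have projP: "proj P"
    unfolding proj_def dim
  proof (intro conjI ballI)
    show "P \<in> carrier_mat n n" by (simp add: P_def)
    fix v :: "real vec" assume v: "v \<in> carrier_vec n"
    show "P *\<^sub>v v \<in> eigenspace A \<theta>" using Pv[OF v] line by auto
    fix w assume "w \<in> eigenspace A \<theta>"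
    then obtain c where w: "w = c \<cdot>\<^sub>v u" using line by auto
    show "(v - P *\<^sub>v v) \<bullet> w = 0"
      using u v uu by (simp add: Pv[OF v] w minus_scalar_prod_distrib[of _ n] comm_scalar_prod[OF u v])
  qed
  have "Q = P" if Q: "proj Q" for Q
  proof (rule eq_matI)
    have carr: "Q \<in> carrier_mat n n" "P \<in> carrier_mat n n"
      using Q projP by (simp_all add: proj_def dim)
    then show "dim_row Q = dim_row P" "dim_col Q = dim_col P" by simp_all
    fix i j assume "i < dim_row P" "j < dim_col P"
    then have ij: "i < n" "j < n" using carr by simp_all
    have "Q *\<^sub>v unit_vec n j = P *\<^sub>v unit_vec n j"
      using unique[OF Q] unique[OF projP] by simp
    then have "(Q *\<^sub>v unit_vec n j) $ i = (P *\<^sub>v unit_vec n j) $ i" by simp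
    then show "Q $$ (i, j) = P $$ (i, j)" using ij carr by simp
  qed
  then have "eigenprojector A \<theta> = P"
    using projP unfolding eigenprojector_def proj_def by (intro the_equality) blast+
  then show ?thesis using Pv[OF x] by simp
qed

section \<open>The Laplacian of the path as a second difference\<close>

lemma laplacian_carrier [simp]: "laplacian n E \<in> carrier_mat n n"
  by (rule carrier_matI) (simp_all add: laplacian_def degree_mat_def adjacency_mat_def)

text \<open>The degree counts the neighbours, so the diagonal term supplies one copy of
  \<open>w $ i\<close> for each neighbour, to be paired with \<open>- w $ j\<close>.\<close>

lemma laplacian_mult_vec:
  assumes i: "i < n" and w: "w \<in> carrier_vec n"
  shows "(laplacian n E *\<^sub>v w) $ i = (\<Sum>j<n. if E (Suc i) (Suc j) then w $ i - w $ j else 0)"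
proof -
  have "card {v \<in> {1..n}. E (Suc i) v} = card {j. j < n \<and> E (Suc i) (Suc j)}"
  proof (rule sym, rule bij_betw_same_card[of Suc])
    show "bij_betw Suc {j. j < n \<and> E (Suc i) (Suc j)} {v \<in> {1..n}. E (Suc i) v}"
      by (rule bij_betwI[where g = "\<lambda>v. v - 1"]) auto
  qed
  also have "real \<dots> = (\<Sum>j<n. if E (Suc i) (Suc j) then 1 else 0)"
    by (simp add: sum.If_cases lessThan_def Int_def)
  finally have deg: "real (card {v \<in> {1..n}. E (Suc i) v}) = \<dots>" .
  have "(laplacian n E *\<^sub>v w) $ i = (\<Sum>j<n. ((if i = j then real (card {v \<in> {1..n}. E (Suc i) v}) else 0)
      - (if E (Suc i) (Suc j) then 1 else 0)) * w $ j)"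
    using i w
    by (simp add: laplacian_def degree_mat_def adjacency_mat_def scalar_prod_def atLeast0LessThan)
  also have "\<dots> = (\<Sum>j<n. if i = j then real (card {v \<in> {1..n}. E (Suc i) v}) * w $ j else 0)
      - (\<Sum>j<n. if E (Suc i) (Suc j) then w $ j else 0)"
    unfolding sum_subtractf[symmetric] by (rule sum.cong) (auto simp: algebra_simps)
  also have "\<dots> = real (card {v \<in> {1..n}. E (Suc i) v}) * w $ i
      - (\<Sum>j<n. if E (Suc i) (Suc j) then w $ j else 0)"
    using i by simp
  also have "\<dots> = (\<Sum>j<n. if E (Suc i) (Suc j) then w $ i - w $ j else 0)"
    unfolding deg sum_distrib_right sum_subtractf[symmetric] by (rule sum.cong) auto
  finally show ?thesis .
qed

lemma laplacian_path_mult_vec: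
  assumes i: "i < n" and w: "w \<in> carrier_vec n"
  shows "(laplacian n (path_adj n) *\<^sub>v w) $ i =
    (if 0 < i then w $ i - w $ (i - 1) else 0) + (if i + 1 < n then w $ i - w $ (i + 1) else 0)"
proof -
  have "(\<Sum>j<n. if path_adj n (Suc i) (Suc j) then w $ i - w $ j else 0) =
     (\<Sum>j<n. (if j = i - 1 then if 0 < i then w $ i - w $ j else 0 else 0)
       + (if j = i + 1 then w $ i - w $ j else 0))"
    using i by (intro sum.cong) (auto simp: path_adj_def)
  also have "\<dots> = (if 0 < i then w $ i - w $ (i - 1) else 0)
      + (if i + 1 < n then w $ i - w $ (i + 1) else 0)"
    unfolding sum.distrib using i by (subst (1 2) sum.delta) auto
  finally show ?thesis using laplacian_mult_vec[OF i w] by simp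
qed

text \<open>Row \<open>m\<close> of the eigenvalue equation determines entry \<open>m + 1\<close>
  from entries \<open>m\<close> and \<open>m - 1\<close>, so a zero first entry propagates along the
  path.\<close>

lemma path_eigenvector_eq_0:
  assumes w: "w \<in> carrier_vec n" and eq: "laplacian n (path_adj n) *\<^sub>v w = \<theta> \<cdot>\<^sub>v w"
    and w0: "w $ 0 = 0" and i: "i < n"
  shows "w $ i = 0"
  using i
proof (induction i rule: less_induct)
  case (less i)
  show ?case
  proof (cases i)
    case 0
    then show ?thesis using w0 by simp
  next
    case (Suc m)
    have m: "w $ m = 0" "w $ (m - 1) = 0" using less Suc by simp_all
    have "(laplacian n (path_adj n) *\<^sub>v w) $ m = \<theta> * w $ m"
      using eq w less.prems Suc by simp
    then show ?thesis
      using laplacian_path_mult_vec[of m n w] w less.prems Suc m by (auto split: if_splits)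
  qed
qed

section \<open>Explicit cosine eigenvectors\<close>

text \<open>This is the DCT-II basis: a cosine sampled at the midpoints \<open>i + 1/2\<close>,
  hence even under reflection about both ends, which matches the missing neighbours there.\<close>

definition path_eigvec :: "nat \<Rightarrow> nat \<Rightarrow> real vec" where
  "path_eigvec n k = vec n (\<lambda>i. cos (real (2 * i + 1) * (real k * pi / (2 * real n))))"

lemma path_eigvec_carrier [simp]: "path_eigvec n k \<in> carrier_vec n"
  by (simp add: path_eigvec_def)

text \<open>The two angles lie at distance \<open>t\<close> on either side of
  \<open>2 * (i + 1) * t\<close>.\<close>

lemma cos_odd_diff:
  "cos (real (2 * i + 1) * t) - cos (real (2 * i + 3) * t) = 2 * sin t * sin (real (2 * (i + 1)) * t)"
proof -
  have "cos (real (2 * i + 1) * t) = cos (real (2 * (i + 1)) * t - t)"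
    and "cos (real (2 * i + 3) * t) = cos (real (2 * (i + 1)) * t + t)"
    by (rule arg_cong[where f = cos], simp add: algebra_simps)+
  then show ?thesis by (simp only: cos_diff cos_add) (simp add: mult.commute)
qed

text \<open>This drop across the edge from vertex \<open>c\<close> to \<open>c + 1\<close> serves
  twice: in the eigenvalue equation and as the inner product with a pair state.\<close>

lemma path_eigvec_diff:
  assumes "1 \<le> c" "c < n"
  shows "path_eigvec n k $ (c - 1) - path_eigvec n k $ c =
    2 * sin (real k * pi / (2 * real n)) * sin (real (c * k) * pi / real n)"
proof -
  obtain i where c: "c = i + 1" using assms(1) by (metis add.commute le_Suc_ex)
  have "sin (real (2 * (i + 1)) * (real k * pi / (2 * real n))) = sin (real (c * k) * pi / real n)"
    using assms by (intro arg_cong[where f = sin]) (simp add: c field_simps)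
  then show ?thesis
    using assms cos_odd_diff[of i "real k * pi / (2 * real n)"]
    by (simp add: c path_eigvec_def add.commute)
qed

text \<open>Row \<open>i\<close> is \<open>d (i + 1) - d i\<close>, with \<open>d c\<close> the drop
  across edge \<open>c\<close>. The sine in \<open>d\<close> vanishes at \<open>c = 0\<close> and
  \<open>c = n\<close>, so the ends obey the same formula as the interior.\<close>

lemma path_eigvec_eq:
  assumes n: "n \<ge> 2"
  shows "laplacian n (path_adj n) *\<^sub>v path_eigvec n k = path_eigval n k \<cdot>\<^sub>v path_eigvec n k"
proof (rule eq_vecI)
  show "dim_vec (laplacian n (path_adj n) *\<^sub>v path_eigvec n k)
      = dim_vec (path_eigval n k \<cdot>\<^sub>v path_eigvec n k)"
    by (simp add: path_eigvec_def laplacian_def adjacency_mat_def)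
  fix i assume "i < dim_vec (path_eigval n k \<cdot>\<^sub>v path_eigvec n k)"
  then have i: "i < n" by (simp add: path_eigvec_def)
  define t where "t = real k * pi / (2 * real n)"
  define d where "d c = 2 * sin t * sin (real (c * k) * pi / real n)" for c
  have left: "(if 0 < i then path_eigvec n k $ i - path_eigvec n k $ (i - 1) else 0) = - d i"
    using path_eigvec_diff[of i n k] i by (auto simp: d_def t_def)
  have right: "(if i + 1 < n then path_eigvec n k $ i - path_eigvec n k $ (i + 1) else 0) = d (i + 1)"
  proof (cases "i + 1 < n")
    case True
    then show ?thesis using path_eigvec_diff[of "i + 1" n k] by (simp add: d_def t_def)
  next
    case False
    then have "i + 1 = n" using i by simp
    then have "d (i + 1) = 2 * sin t * sin (real k * pi)"
      using n by (simp add: d_def mult.assoc)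
    then show ?thesis using False by simp
  qed
  have arg: "real (c * k) * pi / real n = 2 * real c * t" for c
    using n by (simp add: t_def)
  \<comment> \<open>Centring both angles at \<open>(2 * i + 1) * t\<close> brings out the
    eigenvector entry; the remaining factor is the eigenvalue by the double-angle formula.\<close>
  have "d (i + 1) - d i = 2 * sin t * (sin ((2 * real i + 1) * t + t) - sin ((2 * real i + 1) * t - t))"
    unfolding d_def arg by (simp add: algebra_simps)
  also have "\<dots> = 4 * (sin t)\<^sup>2 * cos ((2 * real i + 1) * t)"
    by (simp add: sin_add sin_diff power2_eq_square)
  also have "\<dots> = path_eigval n k * path_eigvec n k $ i"
  proof -
    have "path_eigval n k = 2 - 2 * cos (2 * t)" by (simp add: path_eigval_def t_def)
    also have "\<dots> = 4 * (sin t)\<^sup>2" by (simp add: cos_double_sin)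
    finally show ?thesis using i by (simp add: path_eigvec_def t_def[symmetric] add.commute)
  qed
  finally show "(laplacian n (path_adj n) *\<^sub>v path_eigvec n k) $ i
      = (path_eigval n k \<cdot>\<^sub>v path_eigvec n k) $ i"
    using i left right laplacian_path_mult_vec[OF i path_eigvec_carrier]
    by (simp add: path_eigvec_def)
qed

lemma path_eigvec_0_pos:
  assumes "k < n"
  shows "path_eigvec n k $ 0 > 0"
proof -
  have "real k * pi / (2 * real n) < pi / 2" using assms by (simp add: field_simps)
  moreover have "- (pi / 2) < real k * pi / (2 * real n)"
    by (rule less_le_trans[of _ 0]) simp_all
  ultimately show ?thesis using assms by (simp add: path_eigvec_def cos_gt_zero_pi)
qed

lemma path_eigvec_nonzero:
  assumes "k < n"
  shows "path_eigvec n k \<noteq> 0\<^sub>v n"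
proof
  assume "path_eigvec n k = 0\<^sub>v n"
  then show False using path_eigvec_0_pos[OF assms] assms by simp
qed

section \<open>The spectrum of the path and its simplicity\<close>

text \<open>Subtracting the multiple of the cosine vector with the same first entry as
  \<open>w\<close> leaves a solution of the eigenvalue equation with zero first entry, which is
  zero.\<close>

lemma eigenspace_path:
  assumes n: "n \<ge> 2" and k: "k < n"
  shows "eigenspace (laplacian n (path_adj n)) (path_eigval n k) = {c \<cdot>\<^sub>v path_eigvec n k | c. True}"
proof -
  let ?L = "laplacian n (path_adj n)" and ?u = "path_eigvec n k" and ?t = "path_eigval n k"
  have L: "?L \<in> carrier_mat n n" by simp
  have u: "?u \<in> carrier_vec n" by simp
  note u0 = path_eigvec_0_pos[OF k]
  have "w = (w $ 0 / ?u $ 0) \<cdot>\<^sub>v ?u" if w: "w \<in> carrier_vec n" and eq: "?L *\<^sub>v w = ?t \<cdot>\<^sub>v w" for w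
  proof -
    define r where "r = w $ 0 / ?u $ 0"
    have v: "w - r \<cdot>\<^sub>v ?u \<in> carrier_vec n" using w by simp
    have "?L *\<^sub>v (w - r \<cdot>\<^sub>v ?u) = ?t \<cdot>\<^sub>v w - r \<cdot>\<^sub>v (?t \<cdot>\<^sub>v ?u)"
      using mult_minus_distrib_mat_vec[OF L w smult_carrier_vec[THEN iffD2, OF u]] mult_mat_vec[OF L u]
      by (simp add: eq path_eigvec_eq[OF n])
    also have "\<dots> = ?t \<cdot>\<^sub>v (w - r \<cdot>\<^sub>v ?u)"
      using w by (intro eq_vecI) (auto simp: path_eigvec_def right_diff_distrib)
    finally have "(w - r \<cdot>\<^sub>v ?u) $ i = 0" if "i < n" for i
      by (rule path_eigenvector_eq_0[OF v]) (use u0 k w that in \<open>simp_all add: r_def carrier_vecD[OF u]\<close>)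
    then show ?thesis
      unfolding r_def[symmetric] using w by (intro eq_vecI) (auto simp: path_eigvec_def)
  qed
  moreover have "?L *\<^sub>v (c \<cdot>\<^sub>v ?u) = ?t \<cdot>\<^sub>v (c \<cdot>\<^sub>v ?u)" for c
    using mult_mat_vec[OF L u] by (simp add: path_eigvec_eq[OF n] smult_smult_assoc mult.commute)
  ultimately show ?thesis
    using carrier_matD(1)[OF L] u by (auto simp: eigenspace_def)
qed

text \<open>The angles lie between 0 and \<open>pi\<close>, where the cosine is injective.\<close>

lemma path_eigval_inj: "inj_on (path_eigval n) {..<n}"
proof (rule inj_onI)
  fix j k assume jk: "j \<in> {..<n}" "k \<in> {..<n}" and eq: "path_eigval n j = path_eigval n k"
  have "0 \<le> real m * pi / real n \<and> real m * pi / real n \<le> pi" if "m < n" for m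
    using that by (simp add: field_simps)
  moreover have "cos (real j * pi / real n) = cos (real k * pi / real n)"
    using eq by (simp add: path_eigval_def)
  ultimately have "real j * pi / real n = real k * pi / real n"
    using jk cos_inj_pi by (metis lessThan_iff)
  then show "j = k" using jk by simp
qed

lemma eigenvalue_path_iff:
  assumes n: "n \<ge> 2"
  shows "eigenvalue (laplacian n (path_adj n)) \<theta> \<longleftrightarrow> (\<exists>k<n. \<theta> = path_eigval n k)"
proof -
  let ?L = "laplacian n (path_adj n)"
  have L: "?L \<in> carrier_mat n n" by simp
  have ev: "eigenvalue ?L (path_eigval n k)" if "k < n" for k
    unfolding eigenvalue_def eigenvector_def
    using path_eigvec_eq[OF n] path_eigvec_nonzero[OF that] carrier_matD(1)[OF L] path_eigvec_carrier
    by metis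
  have roots: "{x. eigenvalue ?L x} = {x. poly (char_poly ?L) x = 0}"
    using eigenvalue_root_char_poly[OF L] by simp
  have cp: "char_poly ?L \<noteq> 0" "degree (char_poly ?L) = n"
    using degree_monic_char_poly[OF L] n by auto
  have "path_eigval n ` {..<n} = {x. eigenvalue ?L x}"
  \<comment> \<open>The \<open>n\<close> distinct values already reach the bound that the degree
    puts on the number of roots.\<close>
  proof (rule card_seteq)
    show "finite {x. eigenvalue ?L x}" unfolding roots by (rule poly_roots_finite[OF cp(1)])
    show "path_eigval n ` {..<n} \<subseteq> {x. eigenvalue ?L x}" using ev by auto
    show "card {x. eigenvalue ?L x} \<le> card (path_eigval n ` {..<n})"
      using card_poly_roots_bound[OF cp(1)] cp(2) card_image[OF path_eigval_inj[of n]]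
      by (simp add: roots)
  qed
  then show ?thesis by auto
qed

section \<open>Coefficients of projected pair states\<close>

text \<open>The coordinate along the cosine vector of the projected pair state on edge
  \<open>c\<close>. Equations between projections become equations between these reals.\<close>

definition path_coeff :: "nat \<Rightarrow> nat \<Rightarrow> nat \<Rightarrow> real" where
  "path_coeff n k c = 2 * sin (real k * pi / (2 * real n)) * sin (real (c * k) * pi / real n)
     / (path_eigvec n k \<bullet> path_eigvec n k)"

lemma eigenprojector_path_pair_state:
  assumes n: "n \<ge> 2" and k: "k < n" and c: "1 \<le> c" "c < n"
  shows "eigenprojector (laplacian n (path_adj n)) (path_eigval n k) *\<^sub>v pair_state n c (c + 1)
    = path_coeff n k c \<cdot>\<^sub>v path_eigvec n k"
proof -
  have "path_eigvec n k \<bullet> pair_state n c (c + 1) = path_eigvec n k $ (c - 1) - path_eigvec n k $ c"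
    using c by (simp add: pair_state_def scalar_prod_minus_distrib[of _ n])
  then show ?thesis
    using eigenprojector_line[OF laplacian_carrier path_eigvec_carrier path_eigvec_nonzero[OF k]
        eigenspace_path[OF n k], of "pair_state n c (c + 1)"]
      path_eigvec_diff[OF c]
    by (simp add: pair_state_def path_coeff_def)
qed

lemma sin_pi_frac_eq_0_iff:
  assumes "n > 0"
  shows "sin (real m * pi / real n) = 0 \<longleftrightarrow> n dvd m"
proof
  assume "sin (real m * pi / real n) = 0"
  then obtain i :: int where "real m * pi / real n = of_int i * pi"
    by (auto simp: sin_zero_iff_int2)
  then have "real m = of_int i * real n" using assms by (simp add: field_simps)
  then have "int m = i * int n" by (metis of_int_eq_iff of_int_mult of_int_of_nat_eq)
  then show "n dvd m" by (metis dvd_triv_right int_dvd_int_iff)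
next
  assume "n dvd m"
  then obtain q where "m = n * q" ..
  then show "sin (real m * pi / real n) = 0" using assms by (simp add: mult.commute)
qed

lemma path_eigvec_norm_pos:
  assumes "k < n"
  shows "path_eigvec n k \<bullet> path_eigvec n k > 0"
  using conjugate_square_greater_0_vec[OF path_eigvec_carrier, of n k] path_eigvec_nonzero[OF assms]
  by simp

lemma sin_half_pos:
  assumes "0 < k" "k < n"
  shows "sin (real k * pi / (2 * real n)) > 0"
  using assms by (intro sin_gt_zero) (simp_all add: field_simps)

text \<open>At \<open>k = 0\<close> both sides hold. Otherwise the half-angle sine and the norm are
  positive, so only the sine of \<open>c * k * pi / n\<close> can vanish.\<close>

lemma path_coeff_eq_0_iff:
  assumes k: "k < n"
  shows "path_coeff n k c = 0 \<longleftrightarrow> n dvd c * k"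
proof (cases "k = 0")
  case True
  then show ?thesis by (simp add: path_coeff_def)
next
  case False
  then show ?thesis
    using sin_half_pos[of k n] path_eigvec_norm_pos[OF k] k sin_pi_frac_eq_0_iff[of n "c * k"]
    by (simp add: path_coeff_def)
qed

text \<open>Reflecting the path sends edge \<open>c\<close> to edge \<open>n - c\<close> with
  reversed orientation; analytically, \<open>sin (k * pi - x)\<close> is \<open>sin x\<close> for
  odd \<open>k\<close> and \<open>- sin x\<close> for even \<open>k\<close>. The parity cases of the
  theorem come from here.\<close>

lemma path_coeff_reflect:
  assumes k: "k < n" and c: "c \<le> n"
  shows "path_coeff n k (n - c) = (if odd k then 1 else - 1) * path_coeff n k c"
proof -
  have "real ((n - c) * k) * pi / real n = real k * pi - real (c * k) * pi / real n"
    using k c by (simp add: of_nat_diff field_simps)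
  then have "sin (real ((n - c) * k) * pi / real n)
      = (if odd k then 1 else - 1) * sin (real (c * k) * pi / real n)"
    by (simp add: sin_diff)
  then show ?thesis by (simp add: path_coeff_def)
qed

text \<open>The sine is the cosine of the distance to \<open>pi / 2\<close>, and the cosine is
  injective on such distances. So the two angles coincide or add up to \<open>pi\<close>.\<close>

lemma sin_pi_frac_eq_iff:
  assumes "0 < a" "a < n" "0 < b" "b < n"
    and eq: "sin (real a * pi / real n) = sin (real b * pi / real n)"
  shows "a = b \<or> a + b = n"
proof -
  define f where "f c = real c * pi / real n" for c
  have f: "0 \<le> f c" "f c \<le> pi" if "c < n" for c
    using that by (simp_all add: f_def field_simps)
  have "cos \<bar>pi / 2 - f a\<bar> = cos \<bar>pi / 2 - f b\<bar>"
    using eq unfolding cos_abs_real f_def by (simp add: cos_diff)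
  moreover have "\<bar>pi / 2 - f a\<bar> \<le> pi" "\<bar>pi / 2 - f b\<bar> \<le> pi"
    using f[of a] f[of b] assms by linarith+
  ultimately have "\<bar>pi / 2 - f a\<bar> = \<bar>pi / 2 - f b\<bar>"
    using cos_inj_pi[OF abs_ge_zero _ abs_ge_zero] by blast
  then consider "f a = f b" | "f a + f b = pi" by argo
  then show ?thesis
  proof cases
    case 1
    then show ?thesis using assms by (simp add: f_def)
  next
    case 2
    then have "(real a + real b) * pi = real n * pi" using assms by (simp add: f_def field_simps)
    then have "real (a + b) = real n" by simp
    then show ?thesis by (simp only: of_nat_eq_iff) simp
  qed
qed

lemma smult_path_eigvec_eq_iff:
  assumes "k < n"
  shows "s \<cdot>\<^sub>v path_eigvec n k = t \<cdot>\<^sub>v path_eigvec n k \<longleftrightarrow> s = t"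
proof
  assume "s \<cdot>\<^sub>v path_eigvec n k = t \<cdot>\<^sub>v path_eigvec n k"
  then have "(s \<cdot>\<^sub>v path_eigvec n k) $ 0 = (t \<cdot>\<^sub>v path_eigvec n k) $ 0" by simp
  then show "s = t" using path_eigvec_0_pos[OF assms] assms by (simp add: path_eigvec_def)
qed simp

lemma uminus_smult_path_eigvec: "- (s \<cdot>\<^sub>v path_eigvec n k) = (- s) \<cdot>\<^sub>v path_eigvec n k"
  by (intro eq_vecI) (auto simp: path_eigvec_def)

lemma smult_path_eigvec_eq_0_iff:
  assumes "k < n"
  shows "s \<cdot>\<^sub>v path_eigvec n k = 0\<^sub>v n \<longleftrightarrow> s = 0"
proof -
  have "0 \<cdot>\<^sub>v path_eigvec n k = 0\<^sub>v n" by (intro eq_vecI) (auto simp: path_eigvec_def)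
  then show ?thesis using smult_path_eigvec_eq_iff[OF assms, of s 0] by simp
qed

section \<open>Strong cospectrality, signs and supports\<close>

text \<open>The guard on the first equivalence excludes \<open>a + b = n\<close> with
  \<open>a \<noteq> b\<close>: there \<open>n - b = a\<close>, so \<open>z\<close> is
  \<open>x\<close> itself and is trivially strongly cospectral to it.\<close>

theorem theorem3p2:
  fixes n a b :: nat
  assumes "n \<ge> 2"
    and "1 \<le> a" and "a \<le> n - 1"
    and "1 \<le> b" and "b \<le> n - 1"
  shows
    "let L = laplacian n (path_adj n);
         \<theta> = path_eigval n;
         F = (\<lambda>k. eigenprojector L (\<theta> k));
         x = pair_state n a (a + 1);
         y = pair_state n (n - a) (n - a + 1);
         z = pair_state n (n - b) (n - b + 1)
     in
       ((a + b = n \<longrightarrow> a = b) \<longrightarrow> (strongly_cospectral L x z \<longleftrightarrow> a = b)) \<and>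
       (\<forall>k \<in> {0..n - 1}.
          ((F k *\<^sub>v x = F k *\<^sub>v y \<and> F k *\<^sub>v y = 0\<^sub>v n) \<longleftrightarrow> n dvd a * k) \<and>
          ((F k *\<^sub>v x = F k *\<^sub>v y \<and> F k *\<^sub>v y \<noteq> 0\<^sub>v n) \<longleftrightarrow> odd k \<and> \<not> n dvd a * k) \<and>
          ((F k *\<^sub>v x = - (F k *\<^sub>v y) \<and> - (F k *\<^sub>v y) \<noteq> 0\<^sub>v n) \<longleftrightarrow> even k \<and> \<not> n dvd a * k)) \<and>
       eigenvalue_support L x = eigenvalue_support L y \<and>
       eigenvalue_support L y = {\<theta> k | k. k \<in> {0..n - 1} \<and> \<not> n dvd a * k}"
proof -
  let ?L = "laplacian n (path_adj n)"
  let ?F = "\<lambda>k. eigenprojector ?L (path_eigval n k)"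
  let ?u = "path_eigvec n" and ?s = "path_coeff n"
  have c_less: "a < n" "b < n" "1 \<le> n - a" "n - a < n" "1 \<le> n - b" "n - b < n"
    using assms by auto
  note F = eigenprojector_path_pair_state[OF assms(1), unfolded Suc_eq_plus1[symmetric]]
  note iffs = smult_path_eigvec_eq_iff smult_path_eigvec_eq_0_iff uminus_smult_path_eigvec
  have dim: "dim_row ?L = n" using carrier_matD(1)[OF laplacian_carrier] .
  have refl_a: "?s k (n - a) = (if odd k then 1 else - 1) * ?s k a" if "k < n" for k
    using path_coeff_reflect[OF that] c_less by simp
  have refl_b: "?s k (n - b) = (if odd k then 1 else - 1) * ?s k b" if "k < n" for k
    using path_coeff_reflect[OF that] c_less by simp
  have sc: "strongly_cospectral ?L (pair_state n a (a + 1)) (pair_state n (n - b) (n - b + 1))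
      \<longleftrightarrow> (\<forall>k<n. ?s k a = ?s k b \<or> ?s k a = - ?s k b)"
  proof -
    have "strongly_cospectral ?L (pair_state n a (a + 1)) (pair_state n (n - b) (n - b + 1))
      \<longleftrightarrow> (\<forall>k<n. ?s k a = ?s k (n - b) \<or> ?s k a = - ?s k (n - b))"
      unfolding strongly_cospectral_def eigenvalue_path_iff[OF assms(1)]
      using assms(2) c_less by (auto simp: F iffs)
    \<comment> \<open>Passing from \<open>n - b\<close> to \<open>b\<close> changes the coefficient
      at most by a sign, which the disjunction absorbs.\<close>
    also have "\<dots> \<longleftrightarrow> (\<forall>k<n. ?s k a = ?s k b \<or> ?s k a = - ?s k b)"
      using refl_b by auto
    finally show ?thesis .
  qed
  have cospectral: "a = b"
    if imp: "a + b = n \<longrightarrow> a = b"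
      and cosp: "\<forall>k<n. ?s k a = ?s k b \<or> ?s k a = - ?s k b"
  proof -
    have pos: "?s 1 c > 0" "sin (real c * pi / real n) > 0" if "1 \<le> c" "c < n" for c
    proof -
      show "sin (real c * pi / real n) > 0"
        using that by (intro sin_gt_zero) (simp_all add: field_simps)
      then show "?s 1 c > 0"
        using sin_half_pos[of 1 n] path_eigvec_norm_pos[of 1 n] assms(1) by (simp add: path_coeff_def)
    qed
    \<comment> \<open>At \<open>k = 1\<close> both coefficients are positive, which rules out the
      minus sign.\<close>
    have "?s 1 a = ?s 1 b"
      using cosp[rule_format, of 1] pos(1)[of a] pos(1)[of b] assms c_less by auto
    then have "sin (real a * pi / real n) = sin (real b * pi / real n)"
      using sin_half_pos[of 1 n] path_eigvec_norm_pos[of 1 n] assms(1) by (simp add: path_coeff_def)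
    \<comment> \<open>Equal sines leave \<open>a = b\<close> or \<open>a + b = n\<close>; the guard
      \<open>imp\<close> settles the latter.\<close>
    then show ?thesis using sin_pi_frac_eq_iff[of a n b] assms c_less imp by auto
  qed
  have x0: "?F k *\<^sub>v pair_state n a (a + 1) = 0\<^sub>v n \<longleftrightarrow> n dvd a * k" if "k < n" for k
    using that assms c_less by (simp add: F iffs path_coeff_eq_0_iff)
  have y0: "?F k *\<^sub>v pair_state n (n - a) (n - a + 1) = 0\<^sub>v n \<longleftrightarrow> n dvd a * k" if "k < n" for k
    using that assms c_less refl_a[OF that] path_coeff_eq_0_iff[OF that, of a] by (simp add: F iffs)
  have k_range: "k \<in> {0..n - 1} \<longleftrightarrow> k < n" for k using assms by auto
  \<comment> \<open>The coefficients of the two projections agree up to the parity sign. For the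
    opposite sign, equality forces the coefficient to be zero, that is
    \<open>n dvd a * k\<close>.\<close>
  have eigen: "(?F k *\<^sub>v pair_state n a (a + 1) = ?F k *\<^sub>v pair_state n (n - a) (n - a + 1)
          \<longleftrightarrow> odd k \<or> n dvd a * k) \<and>
      (?F k *\<^sub>v pair_state n a (a + 1) = - (?F k *\<^sub>v pair_state n (n - a) (n - a + 1))
          \<longleftrightarrow> even k \<or> n dvd a * k) \<and>
      (- (?F k *\<^sub>v pair_state n (n - a) (n - a + 1)) = 0\<^sub>v n \<longleftrightarrow> n dvd a * k)" if k: "k < n" for k
    using path_coeff_eq_0_iff[OF k, of a] refl_a[OF k] k assms(2) c_less
    by (simp add: F iffs eq_neg_iff_add_eq_0)
  have suppx: "eigenvalue_support ?L (pair_state n a (a + 1))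
      = {path_eigval n k | k. k \<in> {0..n - 1} \<and> \<not> n dvd a * k}"
    unfolding eigenvalue_support_def eigenvalue_path_iff[OF assms(1)] dim k_range using x0 by auto
  have suppy: "eigenvalue_support ?L (pair_state n (n - a) (n - a + 1))
      = {path_eigval n k | k. k \<in> {0..n - 1} \<and> \<not> n dvd a * k}"
    unfolding eigenvalue_support_def eigenvalue_path_iff[OF assms(1)] dim k_range using y0 by auto
  show ?thesis
    unfolding Let_def sc suppx suppy
  proof (intro conjI ballI)
    show "(a + b = n \<longrightarrow> a = b) \<longrightarrow> (\<forall>k<n. ?s k a = ?s k b \<or> ?s k a = - ?s k b) = (a = b)"
      using cospectral by auto
    fix k assume "k \<in> {0..n - 1}"
    then have k: "k < n" using k_range by blast
    note facts = eigen[OF k] y0[OF k]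
    show "(?F k *\<^sub>v pair_state n a (a + 1) = ?F k *\<^sub>v pair_state n (n - a) (n - a + 1) \<and>
        ?F k *\<^sub>v pair_state n (n - a) (n - a + 1) = 0\<^sub>v n) = (n dvd a * k)"
      using facts by argo
    show "(?F k *\<^sub>v pair_state n a (a + 1) = ?F k *\<^sub>v pair_state n (n - a) (n - a + 1) \<and>
        ?F k *\<^sub>v pair_state n (n - a) (n - a + 1) \<noteq> 0\<^sub>v n) = (odd k \<and> \<not> n dvd a * k)"
      using facts by argo
    show "(?F k *\<^sub>v pair_state n a (a + 1) = - (?F k *\<^sub>v pair_state n (n - a) (n - a + 1)) \<and>
        - (?F k *\<^sub>v pair_state n (n - a) (n - a + 1)) \<noteq> 0\<^sub>v n) = (even k \<and> \<not> n dvd a * k)"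
      using facts by argo
  qed (rule refl)+
qed

end
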